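(* Let $d\in\mathbb N$, $a\in\mathbb N_0$, $n\in\mathbb N_0$. Then, as formal power series in $t$, $$\sum_{m=0}^{\infty}\Big(\sum_{j=0}^m (a+d\,j)^n\Big)\frac{t^m}{m!}=e^t\sum_{j=0}^{n+1}\Sigma S2(d,a;n,j)\,\frac{t^j}{j!},$$ where $\Sigma S2(d,a;n,j):=S2(d,a;n,j)\,j!+S2(d,a;n,j-1)\,(j-1)!$ for $1\le j\le n+1$ and $\Sigma S2(d,a;n,0):=S2(d,a;n,0)$.
   Context: $\mathbb N=\{1,2,\dots\}$, $\mathbb N_0=\{0,1,2,\dots\}$, $0^0:=1$. The generalized Stirling numbers of the second kind $S2(d,a;n,m)$, $0\le m\le n$, are defined by the operator identity $(a\,\mathbf 1+d\,\mathbf E_x)^n=\sum_{m=0}^n S2(d,a;n,m)\,x^m\,\mathbf d_x^{\,m}$, where $\mathbf d_x$ is differentiation with respect to $x$, $\mathbf E_x:=x\,\mathbf d_x$ and $\mathbf 1$ is the identity operator; $S2(d,a;n,m):=0$ for $m>n$. *)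

theory Defs
  imports Complex_Main "HOL-Computational_Algebra.Formal_Power_Series"
begin

text \<open>
  All operators act on formal power series in \<open>x\<close>; \<open>fps_XD\<close> is the Euler operator
  \<open>E\<^sub>x = x d\<^sub>x\<close>.
\<close>

definition stirling_op :: "nat \<Rightarrow> nat \<Rightarrow> real fps \<Rightarrow> real fps" where
  "stirling_op d a f = fps_const (real a) * f + fps_const (real d) * fps_XD f"

definition is_S2 :: "nat \<Rightarrow> nat \<Rightarrow> nat \<Rightarrow> (nat \<Rightarrow> real) \<Rightarrow> bool" where
  "is_S2 d a n c \<longleftrightarrow>
     (\<forall>f. (stirling_op d a ^^ n) f =
            (\<Sum>m=0..n. fps_const (c m) * fps_X ^ m * (fps_deriv ^^ m) f)) \<and>
     (\<forall>m>n. c m = 0)"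

definition S2 :: "nat \<Rightarrow> nat \<Rightarrow> nat \<Rightarrow> nat \<Rightarrow> real" where
  "S2 d a n = (THE c. is_S2 d a n c)"

definition SigmaS2 :: "nat \<Rightarrow> nat \<Rightarrow> nat \<Rightarrow> nat \<Rightarrow> real" where
  "SigmaS2 d a n j =
     (if j = 0 then S2 d a n 0
      else S2 d a n j * fact j + S2 d a n (j - 1) * fact (j - 1))"

text \<open>The defining operator identity has exactly one solution, so \<open>THE\<close> is justified.\<close>

lemma euler_term:
  "fps_XD (fps_const (c::real) * fps_X ^ m * (fps_deriv ^^ m) f) =
     fps_const (real m * c) * fps_X ^ m * (fps_deriv ^^ m) f
     + fps_const c * fps_X ^ Suc m * (fps_deriv ^^ Suc m) f"
proof (rule fps_ext)
  fix i
  define g where "g = (fps_deriv ^^ m) f"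
  have g': "(fps_deriv ^^ Suc m) f = fps_deriv g" by (simp add: g_def)
  have "real i * (c * (if i < m then 0 else fps_nth g (i - m))) =
      real m * c * (if i < m then 0 else fps_nth g (i - m))
      + c * (if i < Suc m then 0 else fps_nth (fps_deriv g) (i - Suc m))"
    by (cases "i \<le> m")
       (auto simp: not_le less_Suc_eq_le Suc_diff_Suc of_nat_diff algebra_simps)
  then show "fps_nth (fps_XD (fps_const c * fps_X ^ m * (fps_deriv ^^ m) f)) i =
      fps_nth (fps_const (real m * c) * fps_X ^ m * (fps_deriv ^^ m) f
        + fps_const c * fps_X ^ Suc m * (fps_deriv ^^ Suc m) f) i"
    unfolding g' g_def[symmetric]
    by (simp only: mult.assoc fps_XD_nth fps_add_nth fps_mult_left_const_nth fps_X_power_mult_nth)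
qed

lemma is_S2_exists: "\<exists>c. is_S2 d a n c"
proof (induction n)
  case 0
  have "is_S2 d a 0 (\<lambda>m. if m = 0 then 1 else 0)"
    by (simp add: is_S2_def)
  then show ?case by blast
next
  case (Suc n)
  then obtain c where c: "is_S2 d a n c" by blast
  define c' where
    "c' m = (real a + real d * real m) * c m + (if m = 0 then 0 else real d * c (m - 1))" for m
  have z: "c m = 0" if "m > n" for m using c that by (simp add: is_S2_def)
  let ?T = "\<lambda>f m. fps_X ^ m * (fps_deriv ^^ m) f :: real fps"
  have "(stirling_op d a ^^ Suc n) f =
          (\<Sum>m=0..Suc n. fps_const (c' m) * fps_X ^ m * (fps_deriv ^^ m) f)" for f
  proof -
    have XD_sum: "fps_XD (\<Sum>m\<in>A. g m) = (\<Sum>m\<in>A. fps_XD (g m))"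
      for g :: "nat \<Rightarrow> real fps" and A
      by (simp add: fps_XD_def fps_deriv_sum sum_distrib_left)
    have "(stirling_op d a ^^ Suc n) f =
            stirling_op d a (\<Sum>m=0..n. fps_const (c m) * fps_X ^ m * (fps_deriv ^^ m) f)"
      using c by (simp add: is_S2_def)
    also have "\<dots> = (\<Sum>m=0..n. fps_const ((real a + real d * real m) * c m) * ?T f m
                        + fps_const (real d * c m) * ?T f (Suc m))"
      unfolding stirling_op_def XD_sum euler_term sum_distrib_left sum.distrib[symmetric]
      by (intro sum.cong refl)
         (simp add: algebra_simps flip: fps_const_mult fps_const_add)
    also have "\<dots> = (\<Sum>m=0..Suc n. fps_const ((real a + real d * real m) * c m) * ?T f m)
                 + (\<Sum>m=0..Suc n. fps_const (if m = 0 then 0 else real d * c (m - 1)) * ?T f m)"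
      by (subst (2) sum.atLeast0_atMost_Suc_shift)
         (simp add: sum.distrib z del: funpow.simps power_Suc)
    also have "\<dots> = (\<Sum>m=0..Suc n. fps_const (c' m) * fps_X ^ m * (fps_deriv ^^ m) f)"
      unfolding sum.distrib[symmetric] c'_def
      by (intro sum.cong refl)
         (simp add: algebra_simps flip: fps_const_add del: funpow.simps power_Suc)
    finally show ?thesis .
  qed
  moreover have "c' m = 0" if "m > Suc n" for m
    using that z by (simp add: c'_def)
  ultimately have "is_S2 d a (Suc n) c'" by (simp add: is_S2_def)
  then show ?case by blast
qed

lemma fps_deriv_funpow_nth:
  "fps_nth ((fps_deriv ^^ m) (f :: real fps)) k = pochhammer (real k + 1) m * fps_nth f (k + m)"
proof (induction m arbitrary: k)
  case (Suc m)
  then show ?case by (simp add: pochhammer_rec algebra_simps)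
qed simp

lemma is_S2_unique:
  assumes "is_S2 d a n c" "is_S2 d a n c'"
  shows "c = c'"
proof
  fix k
  show "c k = c' k"
  proof (induction k rule: less_induct)
    case (less k)
    show ?case
    proof (cases "k \<le> n")
      case False
      then show ?thesis using assms by (simp add: is_S2_def)
    next
      case True
      define f :: "real fps" where "f = Abs_fps (\<lambda>_. 1)"
      define T where "T m = fps_nth (fps_X ^ m * (fps_deriv ^^ m) f) k" for m
      have T0: "T m = 0" if "m > k" for m
        using that by (simp add: T_def fps_X_power_mult_nth)
      have Tk: "T k \<noteq> 0"
        by (simp add: T_def fps_X_power_mult_nth fps_deriv_funpow_nth f_def flip: pochhammer_fact)
      have sum_eq: "fps_nth ((stirling_op d a ^^ n) f) k = (\<Sum>m<k. b m * T m) + b k * T k"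
        if "is_S2 d a n b" for b
      proof -
        have "fps_nth ((stirling_op d a ^^ n) f) k = (\<Sum>m=0..n. b m * T m)"
          using that by (simp add: is_S2_def fps_sum_nth T_def mult.assoc)
        also have "\<dots> = (\<Sum>m<Suc k. b m * T m)"
          using True T0 by (intro sum.mono_neutral_right) auto
        finally show ?thesis by simp
      qed
      have "(\<Sum>m<k. c m * T m) = (\<Sum>m<k. c' m * T m)"
        using less by simp
      then have "c k * T k = c' k * T k"
        using sum_eq[OF assms(1)] sum_eq[OF assms(2)] by linarith
      then show ?thesis using Tk by simp
    qed
  qed
qed

lemma is_S2_S2: "is_S2 d a n (S2 d a n)"
  unfolding S2_def using is_S2_exists is_S2_unique by (metis theI')

end

theory Submission
  imports Defs
begin

text \<open>
  Applied to \<open>exp(x)\<close>, the defining operator identity becomes the binomial expansion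
  \<open>(a + d k)\<^sup>n = \<Sum>m. S2(n,m) m! (k choose m)\<close>. Summing over \<open>k \<le> M\<close> by the hockey-stick identity
  turns \<open>k choose m\<close> into \<open>(M+1) choose (m+1) = (M choose m) + (M choose (m+1))\<close>, which explains
  the two terms of \<open>\<Sigma>S2\<close>; and \<open>M choose j\<close> has exponential generating function \<open>e\<^sup>t t\<^sup>j / j!\<close>.
\<close>

text \<open>The operator is diagonal on monomials: \<open>x^k\<close> is an eigenvector with
  eigenvalue \<open>a + d k\<close>.\<close>

lemma stirling_op_funpow_nth:
  "fps_nth ((stirling_op d a ^^ n) f) k = (real a + real d * real k) ^ n * fps_nth f k"
  by (induction n) (simp_all add: stirling_op_def algebra_simps)

lemma fps_deriv_funpow_exp: "(fps_deriv ^^ m) (fps_exp (1::real)) = fps_exp 1"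
  by (induction m) simp_all

lemma fps_exp_times_X_power_nth:
  "fps_nth (fps_X ^ j * fps_exp (1::real)) k = real (k choose j) * fact j / fact k"
proof (cases "k < j")
  case False
  then show ?thesis
    by (simp add: fps_X_power_mult_nth binomial_fact)
qed (simp add: fps_X_power_mult_nth)

lemma power_conv_S2_binomial:
  "(real a + real d * real k) ^ n = (\<Sum>m=0..n. S2 d a n m * fact m * real (k choose m))"
proof -
  \<comment> \<open>\<open>fps_exp 1\<close> is its own derivative, so only the powers of
    \<open>fps_X\<close> remain.\<close>
  have "(stirling_op d a ^^ n) (fps_exp 1) =
      (\<Sum>m=0..n. fps_const (S2 d a n m) * (fps_X ^ m * fps_exp 1))"
    using is_S2_S2[of d a n] by (simp add: is_S2_def fps_deriv_funpow_exp mult.assoc)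
  then have "fps_nth ((stirling_op d a ^^ n) (fps_exp 1)) k =
      (\<Sum>m=0..n. S2 d a n m * (real (k choose m) * fact m / fact k))"
    by (simp add: fps_sum_nth fps_exp_times_X_power_nth del: fps_exp_nth)
  then have "(real a + real d * real k) ^ n / fact k =
      (\<Sum>m=0..n. S2 d a n m * fact m * real (k choose m)) / fact k"
    by (simp add: stirling_op_funpow_nth sum_divide_distrib mult_ac)
  then show ?thesis by simp
qed

lemma sum_power_conv_SigmaS2_binomial:
  "(\<Sum>k=0..M. (real a + real d * real k) ^ n) =
     (\<Sum>j=0..n+1. SigmaS2 d a n j * real (M choose j))"
proof -
  let ?c = "\<lambda>m. S2 d a n m * fact m"
  \<comment> \<open>This lets the first sum after Pascal's rule be extended to \<open>Suc n\<close>
    for free.\<close>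
  have z: "S2 d a n (Suc n) = 0"
    using is_S2_S2[of d a n] by (simp add: is_S2_def)
  have "(\<Sum>k=0..M. (real a + real d * real k) ^ n) =
      (\<Sum>m=0..n. \<Sum>k=0..M. ?c m * real (k choose m))"
    unfolding power_conv_S2_binomial by (rule sum.swap)
  also have "\<dots> = (\<Sum>m=0..n. ?c m * real (Suc M choose Suc m))"
    by (simp only: sum_distrib_left[symmetric] of_nat_sum[symmetric] sum_choose_upper
        atLeast0AtMost)
  also have "\<dots> = (\<Sum>m=0..Suc n. ?c m * real (M choose m)) +
      (\<Sum>m=0..n. ?c m * real (M choose Suc m))"
    by (simp add: z sum.distrib algebra_simps)
  also have "\<dots> = (\<Sum>j=0..n+1. SigmaS2 d a n j * real (M choose j))"
    \<comment> \<open>Splitting off \<open>j = 0\<close> matches the case distinction in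
      \<open>SigmaS2\<close>; the other terms then pair up at index \<open>Suc m\<close>.\<close>
    by (simp only: sum.atLeast0_atMost_Suc_shift Suc_eq_plus1[symmetric])
       (simp add: SigmaS2_def sum.distrib algebra_simps)
  finally show ?thesis .
qed

theorem mainTheorem3:
  fixes d a n :: nat
  assumes "d \<ge> 1"
  shows "Abs_fps (\<lambda>m. (\<Sum>j=0..m. (real a + real d * real j) ^ n) / fact m) =
         fps_exp (1::real) * (\<Sum>j=0..n+1. fps_const (SigmaS2 d a n j / fact j) * fps_X ^ j)"
proof (rule fps_ext)
  fix M
  \<comment> \<open>The exponential is moved inside the sum, next to each power of
    \<open>fps_X\<close>, to read off coefficients termwise.\<close>
  have "fps_exp (1::real) * (\<Sum>j=0..n+1. fps_const (SigmaS2 d a n j / fact j) * fps_X ^ j) =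
      (\<Sum>j=0..n+1. fps_const (SigmaS2 d a n j / fact j) * (fps_X ^ j * fps_exp 1))"
    unfolding sum_distrib_left by (simp only: mult_ac)
  then have "fps_nth (fps_exp (1::real) *
        (\<Sum>j=0..n+1. fps_const (SigmaS2 d a n j / fact j) * fps_X ^ j)) M =
      (\<Sum>j=0..n+1. SigmaS2 d a n j / fact j * (real (M choose j) * fact j / fact M))"
    by (simp only: fps_sum_nth fps_mult_left_const_nth fps_exp_times_X_power_nth)
  also have "\<dots> = (\<Sum>j=0..n+1. SigmaS2 d a n j * real (M choose j)) / fact M"
    unfolding sum_divide_distrib by (intro sum.cong refl) simp
  finally show "fps_nth (Abs_fps (\<lambda>m. (\<Sum>j=0..m. (real a + real d * real j) ^ n) / fact m)) M =
      fps_nth (fps_exp (1::real) *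
        (\<Sum>j=0..n+1. fps_const (SigmaS2 d a n j / fact j) * fps_X ^ j)) M"
    by (simp only: sum_power_conv_SigmaS2_binomial fps_nth_Abs_fps)
qed

end
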